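(* If $t$ is a closed normal term of star type $\rho^*$ in the star combinatory calculus for arithmetic, then $t$ is set-like and $\mathrm{SM}(t)$ is a finite non-empty set of closed normal terms of type $\rho$.
   Context: Star combinatory calculus for arithmetic: types are generated from the ground type $N$ by $\sigma\to\tau$ and $\sigma^*$. Constants: $0:N$, $S:N\to N$, $R_\sigma:N\to\sigma\to(\sigma\to N\to\sigma)\to\sigma$; $\Pi_{\sigma,\tau}:\sigma\to\tau\to\sigma$; $\Sigma_{\rho,\sigma,\tau}:(\rho\to\sigma\to\tau)\to(\rho\to\sigma)\to\rho\to\tau$; $\mathfrak{s}_\sigma:\sigma\to\sigma^*$; $\cup_\sigma:\sigma^*\to\sigma^*\to\sigma^*$; $\bigcup_{\sigma,\tau}:\sigma^*\to(\sigma\to\tau^* )\to\tau^*$. Terms: constants, typed variables, applications; closed means containing no variables. Conversions: $\Sigma tqr\rightsquigarrow tr(qr)$; $\Pi tq\rightsquigarrow t$; $\bigcup(\mathfrak{s}t)q\rightsquigarrow qt$; $\bigcup(\cup tq)r\rightsquigarrow\cup(\bigcup tr)(\bigcup qr)$; $R0qr\rightsquigarrow q$; $R(St)qr\rightsquigarrow r(Rtqr)t$. A term is normal if no conversion applies to any of its subterms. A term of star type is set-like if it is built from terms of the form $\mathfrak{s}q$ using only the constant $\cup$ (i.e. it is $\mathfrak{s}q$ or $\cup t_1t_2$ with $t_1,t_2$ set-like). For $t$ of type $\sigma^*$, the surface elements $\mathrm{SM}(t)$ are: $\{q\}$ if $t=\mathfrak{s}q$; $\mathrm{SM}(q)\cup\mathrm{SM}(r)$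 if $t=\cup qr$; $\emptyset$ otherwise. *)

theory Defs
  imports Main
begin

datatype ty =
    N
  | Arr ty ty  (infixr "\<rightarrow>" 65)
  | Star ty  ("_\<^sup>\<star>" [1000] 999)

datatype comb =
    Zero
  | Succ
  | Rec ty
  | Pi ty ty
  | Sigma ty ty ty
  | Sing ty
  | Cup ty
  | BigCup ty ty

primrec comb_ty :: "comb \<Rightarrow> ty" where
  "comb_ty Zero = N"
| "comb_ty Succ = N \<rightarrow> N"
| "comb_ty (Rec \<sigma>) = N \<rightarrow> \<sigma> \<rightarrow> (\<sigma> \<rightarrow> N \<rightarrow> \<sigma>) \<rightarrow> \<sigma>"
| "comb_ty (Pi \<sigma> \<tau>) = \<sigma> \<rightarrow> \<tau> \<rightarrow> \<sigma>"
| "comb_ty (Sigma \<rho> \<sigma> \<tau>) = (\<rho> \<rightarrow> \<sigma> \<rightarrow> \<tau>) \<rightarrow> (\<rho> \<rightarrow> \<sigma>) \<rightarrow> \<rho> \<rightarrow> \<tau>"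
| "comb_ty (Sing \<sigma>) = \<sigma> \<rightarrow> \<sigma>\<^sup>\<star>"
| "comb_ty (Cup \<sigma>) = \<sigma>\<^sup>\<star> \<rightarrow> \<sigma>\<^sup>\<star> \<rightarrow> \<sigma>\<^sup>\<star>"
| "comb_ty (BigCup \<sigma> \<tau>) = \<sigma>\<^sup>\<star> \<rightarrow> (\<sigma> \<rightarrow> \<tau>\<^sup>\<star>) \<rightarrow> \<tau>\<^sup>\<star>"

text \<open>
  Raw application trees, in which variables carry their type (Church style). The terms of type
  \<open>\<sigma>\<close> of the calculus are the raw terms \<open>t\<close> with \<open>has_type t \<sigma>\<close>.
\<close>

datatype trm =
    Var nat ty
  | Con comb
  | App trm trm  (infixl "\<cdot>" 100)

inductive has_type :: "trm \<Rightarrow> ty \<Rightarrow> bool" where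
  "has_type (Var x \<sigma>) \<sigma>"
| "has_type (Con c) (comb_ty c)"
| "has_type t (\<sigma> \<rightarrow> \<tau>) \<Longrightarrow> has_type q \<sigma> \<Longrightarrow> has_type (t \<cdot> q) \<tau>"

primrec vars :: "trm \<Rightarrow> (nat \<times> ty) set" where
  "vars (Var x \<sigma>) = {(x, \<sigma>)}"
| "vars (Con c) = {}"
| "vars (t \<cdot> q) = vars t \<union> vars q"

definition closed_trm :: "trm \<Rightarrow> bool" where
  "closed_trm t \<longleftrightarrow> vars t = {}"

primrec subterms :: "trm \<Rightarrow> trm set" where
  "subterms (Var x \<sigma>) = {Var x \<sigma>}"
| "subterms (Con c) = {Con c}"
| "subterms (t \<cdot> q) = {t \<cdot> q} \<union> subterms t \<union> subterms q"

text \<open>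
  The repeated type indices on the left-hand sides are no restriction: they coincide in every
  well-typed term of the given shape.
\<close>

inductive conv :: "trm \<Rightarrow> trm \<Rightarrow> bool"  (infix "\<leadsto>" 50) where
  "Con (Sigma \<rho> \<sigma> \<tau>) \<cdot> t \<cdot> q \<cdot> r \<leadsto> t \<cdot> r \<cdot> (q \<cdot> r)"
| "Con (Pi \<sigma> \<tau>) \<cdot> t \<cdot> q \<leadsto> t"
| "Con (BigCup \<sigma> \<tau>) \<cdot> (Con (Sing \<sigma>) \<cdot> t) \<cdot> q \<leadsto> q \<cdot> t"
| "Con (BigCup \<sigma> \<tau>) \<cdot> (Con (Cup \<sigma>) \<cdot> t \<cdot> q) \<cdot> r \<leadsto>
     Con (Cup \<tau>) \<cdot> (Con (BigCup \<sigma> \<tau>) \<cdot> t \<cdot> r) \<cdot> (Con (BigCup \<sigma> \<tau>) \<cdot> q \<cdot> r)"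
| "Con (Rec \<sigma>) \<cdot> Con Zero \<cdot> q \<cdot> r \<leadsto> q"
| "Con (Rec \<sigma>) \<cdot> (Con Succ \<cdot> t) \<cdot> q \<cdot> r \<leadsto> r \<cdot> (Con (Rec \<sigma>) \<cdot> t \<cdot> q \<cdot> r) \<cdot> t"

definition normal :: "trm \<Rightarrow> bool" where
  "normal t \<longleftrightarrow> (\<forall>s \<in> subterms t. \<not> (\<exists>u. s \<leadsto> u))"

inductive set_like :: "trm \<Rightarrow> bool" where
  "has_type q \<sigma> \<Longrightarrow> set_like (Con (Sing \<sigma>) \<cdot> q)"
| "set_like t\<^sub>1 \<Longrightarrow> set_like t\<^sub>2 \<Longrightarrow> has_type t\<^sub>1 (\<sigma>\<^sup>\<star>) \<Longrightarrow> has_type t\<^sub>2 (\<sigma>\<^sup>\<star>) \<Longrightarrow>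
   set_like (Con (Cup \<sigma>) \<cdot> t\<^sub>1 \<cdot> t\<^sub>2)"

fun SM :: "trm \<Rightarrow> trm set" where
  "SM (Con (Sing \<sigma>) \<cdot> q) = {q}"
| "SM (Con (Cup \<sigma>) \<cdot> q \<cdot> r) = SM q \<union> SM r"
| "SM _ = {}"

end

theory Submission
  imports Defs
begin

text \<open>
  Call a term an introduction form if it is a constant applied to too few arguments for a conversion
  (for \<open>S\<close>, \<open>\<ss>\<close>, \<open>\<union>\<close>: to any number of arguments), where the argument on which \<open>R\<close> or
  \<open>\<Union>\<close> branches, if present, has one of the shapes that trigger a conversion. Every closed
  normal term is of this form, by induction on typing: a closed normal argument of type \<open>N\<close> or
  \<open>\<sigma>\<^sup>\<star>\<close> is headed by a constructor, so supplying the last argument of \<open>R\<close> or \<open>\<Union>\<close> would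
  create a redex. The only introduction forms of star type are \<open>\<ss>q\<close> and \<open>\<union>qr\<close>.
\<close>

inductive intro_form :: "trm \<Rightarrow> bool" where
  intro_Con: "intro_form (Con c)"
| intro_Succ: "intro_form (Con Succ \<cdot> t)"
| intro_Rec_Zero1: "intro_form (Con (Rec \<sigma>) \<cdot> Con Zero)"
| intro_Rec_Zero2: "intro_form (Con (Rec \<sigma>) \<cdot> Con Zero \<cdot> q)"
| intro_Rec_Succ1: "intro_form (Con (Rec \<sigma>) \<cdot> (Con Succ \<cdot> t))"
| intro_Rec_Succ2: "intro_form (Con (Rec \<sigma>) \<cdot> (Con Succ \<cdot> t) \<cdot> q)"
| intro_Pi: "intro_form (Con (Pi \<sigma> \<tau>) \<cdot> t)"
| intro_Sigma1: "intro_form (Con (Sigma \<rho> \<sigma> \<tau>) \<cdot> t)"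
| intro_Sigma2: "intro_form (Con (Sigma \<rho> \<sigma> \<tau>) \<cdot> t \<cdot> q)"
| intro_Sing: "intro_form (Con (Sing \<sigma>) \<cdot> t)"
| intro_Cup1: "intro_form (Con (Cup \<sigma>) \<cdot> t)"
| intro_Cup2: "intro_form (Con (Cup \<sigma>) \<cdot> t \<cdot> q)"
| intro_BigCup_Sing: "intro_form (Con (BigCup \<sigma> \<tau>) \<cdot> (Con (Sing \<sigma>) \<cdot> t))"
| intro_BigCup_Cup: "intro_form (Con (BigCup \<sigma> \<tau>) \<cdot> (Con (Cup \<sigma>) \<cdot> t \<cdot> q))"

lemma has_type_Con_iff [simp]: "has_type (Con c) \<sigma> \<longleftrightarrow> \<sigma> = comb_ty c"
  by (subst has_type.simps) auto

lemma has_type_App_iff [simp]: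
  "has_type (t \<cdot> q) \<tau> \<longleftrightarrow> (\<exists>\<sigma>. has_type t (\<sigma> \<rightarrow> \<tau>) \<and> has_type q \<sigma>)"
  by (subst has_type.simps) auto

lemma closed_trm_simps [simp]:
  "\<not> closed_trm (Var x \<sigma>)"
  "closed_trm (Con c)"
  "closed_trm (t \<cdot> q) \<longleftrightarrow> closed_trm t \<and> closed_trm q"
  by (auto simp: closed_trm_def)

lemma normal_App: "normal (t \<cdot> q) \<longleftrightarrow> (\<nexists>u. t \<cdot> q \<leadsto> u) \<and> normal t \<and> normal q"
  by (auto simp: normal_def)

lemma intro_form_N:
  assumes "intro_form t" "has_type t N"
  shows "t = Con Zero \<or> (\<exists>q. t = Con Succ \<cdot> q)"
  using assms
proof cases
  case (intro_Con c)
  with assms(2) show ?thesis by (cases c) auto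
qed auto

text \<open>Too few arguments leave an arrow type. Pinning the index to \<open>\<sigma>\<close>
  matters: the conversions for \<open>BigCup\<close> require equal indices.\<close>

lemma intro_form_Star:
  assumes "intro_form t" "has_type t (\<sigma>\<^sup>\<star>)"
  shows "(\<exists>q. t = Con (Sing \<sigma>) \<cdot> q) \<or> (\<exists>q r. t = Con (Cup \<sigma>) \<cdot> q \<cdot> r)"
  using assms
proof cases
  case (intro_Con c)
  with assms(2) show ?thesis by (cases c) auto
qed auto

lemma intro_form_App:
  assumes "intro_form t" "intro_form q" "has_type t (\<sigma> \<rightarrow> \<tau>)" "has_type q \<sigma>"
    and irreducible: "\<nexists>u. t \<cdot> q \<leadsto> u"
  shows "intro_form (t \<cdot> q)"
  using assms(1)
proof cases
  case (intro_Con c)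
  show ?thesis
  proof (cases c)
    case (Rec \<rho>)
    with intro_Con assms have "has_type q N" by simp
    with intro_form_N assms(2) Rec intro_Con show ?thesis
      by (auto intro: intro_form.intros)
  next
    case (BigCup \<rho> \<rho>')
    with intro_Con assms have "has_type q (\<rho>\<^sup>\<star>)" by simp
    with intro_form_Star assms(2) BigCup intro_Con show ?thesis
      by (fastforce intro: intro_form.intros)
  qed (use intro_Con assms in \<open>auto intro: intro_form.intros\<close>)
\<comment> \<open>\<open>t\<close> is now a proper application: the extra argument completes a
  redex, is excluded by the arrow type of \<open>t\<close>, or yields the next longer introduction
  form.\<close>
qed (use assms(3) irreducible in
    \<open>simp, blast intro: intro_form.intros conv.intros\<close>)+

lemma closed_normal_intro_form:
  assumes "has_type t \<sigma>" "closed_trm t" "normal t"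
  shows "intro_form t"
  using assms
proof induction
  case (3 t \<sigma> \<tau> q)
  then show ?case by (simp add: normal_App intro_form_App)
qed (simp_all add: intro_Con)

theorem theorem11:
  fixes t :: trm and \<rho> :: ty
  assumes "has_type t (\<rho>\<^sup>\<star>)"
    and "closed_trm t"
    and "normal t"
  shows "set_like t \<and> finite (SM t) \<and> SM t \<noteq> {} \<and>
         (\<forall>q \<in> SM t. has_type q \<rho> \<and> closed_trm q \<and> normal q)"
  using assms
\<comment> \<open>Induction on size, because in \<open>Con (Cup \<rho>) \<cdot> q \<cdot> r\<close>
  the term \<open>q\<close> is not an immediate subterm.\<close>
proof (induction "size t" arbitrary: t rule: less_induct)
  case less
  then consider q where "t = Con (Sing \<rho>) \<cdot> q"
    | q r where "t = Con (Cup \<rho>) \<cdot> q \<cdot> r"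
    using closed_normal_intro_form intro_form_Star by blast
  then show ?case
  proof cases
    case 1
    with less.prems show ?thesis by (auto simp: normal_App intro: set_like.intros)
  next
    case 2
    with less.prems have "has_type q (\<rho>\<^sup>\<star>)" "closed_trm q" "normal q"
      and "has_type r (\<rho>\<^sup>\<star>)" "closed_trm r" "normal r"
      by (simp_all add: normal_App)
    with less.hyps[of q] less.hyps[of r] 2 show ?thesis
      by (simp add: set_like.intros ball_Un)
  qed
qed

end
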